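(* Let $\mathbb{K}$ be a field of characteristic zero and let $R$ be a relational structure with domain $E$ (the number of isomorphism types of $n$-element substructures of $R$ may be infinite). If the kernel of $R$ is empty, then the age algebra $\mathbb{K}.\mathcal{A}(R)$ is an integral domain.
   Context: A relational structure is $R=(E,(\rho_i)_{i\in I})$ with $\rho_i\subseteq E^{m_i}$; for $A\subseteq E$, $R_{\restriction A}$ is the induced substructure. The age $\mathcal{A}(R)$ is the set of isomorphism types of finite induced substructures. The kernel of $R$ is $K(R)=\{x\in E:\mathcal{A}(R_{\restriction E\setminus\{x\}})\neq\mathcal{A}(R)\}$. Set algebra: let $[E]^{<\omega}$ be the set of finite subsets of $E$; the set algebra is the $\mathbb{K}$-vector space of maps $f:[E]^{<\omega}\to\mathbb{K}$ such that $f(P)=0$ whenever $|P|$ is large enough, with product $(fg)(Q)=\sum_{P\subseteq Q}f(P)g(Q\setminus P)$. Write $F\equiv_R F'$ if $R_{\restriction F}$ and $R_{\restriction F'}$ are isomorphic. The age algebra $\mathbb{K}.\mathcal{A}(R)$ is the subalgebra of the set algebra consisting of the maps constant on each $\equiv_R$-class. *)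

theory Defs
  imports "HOL-Algebra.Module"
begin

text \<open>The relation \<open>\<rho>\<^sub>i\<close> is a set of lists of length \<open>m\<^sub>i\<close>. The fields \<open>arity\<close> and \<open>rels\<close> are
  meaningful only on the index set.\<close>

record ('a, 'i) rel_structure =
  universe :: "'a set"
  index_set :: "'i set"
  arity :: "'i \<Rightarrow> nat"
  rels :: "'i \<Rightarrow> 'a list set"

definition relational_structure :: "('a, 'i) rel_structure \<Rightarrow> bool" where
  "relational_structure R \<longleftrightarrow>
     (\<forall>i\<in>index_set R. rels R i \<subseteq> {xs. length xs = arity R i \<and> set xs \<subseteq> universe R})"

text \<open>Only meant for \<open>A \<subseteq> universe R\<close>.\<close>

definition induced :: "('a, 'i) rel_structure \<Rightarrow> 'a set \<Rightarrow> ('a, 'i) rel_structure" where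
  "induced R A = R\<lparr>universe := A, rels := \<lambda>i. {xs \<in> rels R i. set xs \<subseteq> A}\<rparr>"

definition rel_isomorphic :: "('a, 'i) rel_structure \<Rightarrow> ('a, 'i) rel_structure \<Rightarrow> bool" where
  "rel_isomorphic R S \<longleftrightarrow>
     index_set R = index_set S \<and> (\<forall>i\<in>index_set R. arity R i = arity S i) \<and>
     (\<exists>h. bij_betw h (universe R) (universe S) \<and>
        (\<forall>i\<in>index_set R. \<forall>xs. length xs = arity R i \<and> set xs \<subseteq> universe R \<longrightarrow>
           (xs \<in> rels R i \<longleftrightarrow> map h xs \<in> rels S i)))"

text \<open>An isomorphism type is an isomorphism class of structures over the ambient type \<open>'a\<close>; this
  suffices for comparing ages of restrictions of one structure.\<close>

definition iso_type :: "('a, 'i) rel_structure \<Rightarrow> ('a, 'i) rel_structure set" where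
  "iso_type R = {S. relational_structure S \<and> rel_isomorphic R S}"

definition age :: "('a, 'i) rel_structure \<Rightarrow> ('a, 'i) rel_structure set set" where
  "age R = {iso_type (induced R F) | F. F \<in> Fpow (universe R)}"

definition rel_kernel :: "('a, 'i) rel_structure \<Rightarrow> 'a set" where
  "rel_kernel R = {x \<in> universe R. age (induced R (universe R - {x})) \<noteq> age R}"

text \<open>A map \<open>[E]\<^sup><\<^sup>\<omega> \<rightarrow> \<bbbK>\<close> is represented by its extension by \<open>0\<close> to all sets. The product needs no
  case distinction: on an infinite \<open>Q\<close> the sum is \<open>0\<close> by convention, and if \<open>Q\<close> is not contained in
  \<open>E\<close> then \<open>P\<close> and \<open>Q - P\<close> are not both contained in \<open>E\<close>, so that every summand vanishes.\<close>

definition set_algebra :: "'a set \<Rightarrow> ('k::field, 'a set \<Rightarrow> 'k) module" where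
  "set_algebra E = \<lparr>
     carrier = {f. (\<forall>P. P \<notin> Fpow E \<longrightarrow> f P = 0) \<and> (\<exists>n. \<forall>P\<in>Fpow E. card P \<ge> n \<longrightarrow> f P = 0)},
     monoid.mult = \<lambda>f g Q. \<Sum>P\<in>Pow Q. f P * g (Q - P),
     one = \<lambda>P. if P = {} then 1 else 0,
     zero = \<lambda>P. 0,
     add = \<lambda>f g P. f P + g P,
     smult = \<lambda>c f P. c * f P\<rparr>"

definition age_equiv :: "('a, 'i) rel_structure \<Rightarrow> 'a set \<Rightarrow> 'a set \<Rightarrow> bool" where
  "age_equiv R F F' \<longleftrightarrow> rel_isomorphic (induced R F) (induced R F')"

definition age_algebra :: "('a, 'i) rel_structure \<Rightarrow> ('k::field, 'a set \<Rightarrow> 'k) module" where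
  "age_algebra R = set_algebra (universe R)
     \<lparr>carrier := {f \<in> carrier (set_algebra (universe R)).
        \<forall>F\<in>Fpow (universe R). \<forall>F'\<in>Fpow (universe R). age_equiv R F F' \<longrightarrow> f F = f F'}\<rparr>"

lemma rel_isomorphic_refl: "rel_isomorphic R R"
  unfolding rel_isomorphic_def by (auto intro!: exI[of _ id])

lemma rel_isomorphic_sym:
  assumes "rel_isomorphic R S"
  shows "rel_isomorphic S R"
proof -
  obtain h where h: "bij_betw h (universe R) (universe S)"
    and eq: "index_set R = index_set S" "\<forall>i\<in>index_set R. arity R i = arity S i"
    and r: "\<And>i xs. i \<in> index_set R \<Longrightarrow> length xs = arity R i \<Longrightarrow> set xs \<subseteq> universe R \<Longrightarrow>
              xs \<in> rels R i \<longleftrightarrow> map h xs \<in> rels S i"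
    using assms unfolding rel_isomorphic_def by blast
  let ?g = "inv_into (universe R) h"
  have g: "bij_betw ?g (universe S) (universe R)"
    using h by (rule bij_betw_inv_into)
  have "ys \<in> rels S i \<longleftrightarrow> map ?g ys \<in> rels R i"
    if "i \<in> index_set S" "length ys = arity S i" "set ys \<subseteq> universe S" for i ys
  proof -
    have "set (map ?g ys) \<subseteq> universe R"
      using that(3) g by (auto simp: bij_betw_def)
    moreover have "map h (map ?g ys) = ys"
      using that(3) h by (auto intro!: map_idI simp: bij_betw_inv_into_right subset_iff)
    ultimately show ?thesis
      using r[of i "map ?g ys"] that eq by simp
  qed
  then show ?thesis
    unfolding rel_isomorphic_def using g eq by auto
qed

lemma rel_isomorphic_trans:
  assumes "rel_isomorphic R S" "rel_isomorphic S T"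
  shows "rel_isomorphic R T"
proof -
  obtain h where h: "bij_betw h (universe R) (universe S)"
    and eq: "index_set R = index_set S" "\<forall>i\<in>index_set R. arity R i = arity S i"
    and r: "\<And>i xs. i \<in> index_set R \<Longrightarrow> length xs = arity R i \<Longrightarrow> set xs \<subseteq> universe R \<Longrightarrow>
              xs \<in> rels R i \<longleftrightarrow> map h xs \<in> rels S i"
    using assms(1) unfolding rel_isomorphic_def by blast
  obtain g where g: "bij_betw g (universe S) (universe T)"
    and eq': "index_set S = index_set T" "\<forall>i\<in>index_set S. arity S i = arity T i"
    and r': "\<And>i xs. i \<in> index_set S \<Longrightarrow> length xs = arity S i \<Longrightarrow> set xs \<subseteq> universe S \<Longrightarrow>
              xs \<in> rels S i \<longleftrightarrow> map g xs \<in> rels T i"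
    using assms(2) unfolding rel_isomorphic_def by blast
  have "xs \<in> rels R i \<longleftrightarrow> map (g \<circ> h) xs \<in> rels T i"
    if "i \<in> index_set R" "length xs = arity R i" "set xs \<subseteq> universe R" for i xs
  proof -
    have "set (map h xs) \<subseteq> universe S"
      using that(3) h by (auto simp: bij_betw_def)
    then show ?thesis
      using r[of i xs] r'[of i "map h xs"] that eq by simp
  qed
  moreover have "bij_betw (g \<circ> h) (universe R) (universe T)"
    using h g by (rule bij_betw_trans)
  ultimately show ?thesis
    unfolding rel_isomorphic_def using eq eq' by auto
qed

lemma iso_type_eq_iff:
  assumes "relational_structure S"
  shows "iso_type R = iso_type S \<longleftrightarrow> rel_isomorphic R S"
  using assms rel_isomorphic_refl rel_isomorphic_sym rel_isomorphic_trans
  unfolding iso_type_def by blast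

end

(*
  Call a map on finite sets thin if it vanishes on all finite sets avoiding some finite T. Modulo thin
  maps, f |-> f(. Un B) behaves like a higher derivation. If fg = 0, then differentiating at a point x
  and multiplying by g gives f_x g^2 = 0; differentiating repeatedly along a set in the support of f
  turns f into a unit, so g is nilpotent. Conversely a map g of bounded degree that is not thin is not
  nilpotent modulo thin maps: take B nonempty and minimal such that g_B = g(. Un B) is not thin. All
  mixed terms of the Leibniz rule for B are thin, so g^N = 0 yields N g^(N-1) g_B = 0, and g_B, having
  smaller degree, is not a zero divisor by induction; characteristic zero gives g^(N-1) = 0.

  When the kernel is empty, no nonzero element of the age algebra is thin. Otherwise some finite F
  has a finite set meeting all its copies; let T be one of minimal size. A finite family of copies of F
  already has no smaller transversal, so T is contained in every copy of the union G of this family,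
  yet G has a copy avoiding a given point of T.
*)

theory Submission
  imports Defs
begin

section \<open>The convolution product on maps defined on sets\<close>

text \<open>The product of the set algebra is set apart from its record so that it also applies to
  translates \<open>\<lambda>P. f (P \<union> B)\<close>, which need not be constant on isomorphism
  classes.\<close>

definition conv :: "('a set \<Rightarrow> 'k::field) \<Rightarrow> ('a set \<Rightarrow> 'k) \<Rightarrow> 'a set \<Rightarrow> 'k" where
  "conv f g Q = (\<Sum>P\<in>Pow Q. f P * g (Q - P))"

definition conv_one :: "'a set \<Rightarrow> 'k::field" where
  "conv_one P = (if P = {} then 1 else 0)"

primrec conv_pow :: "('a set \<Rightarrow> 'k::field) \<Rightarrow> nat \<Rightarrow> 'a set \<Rightarrow> 'k" where
  "conv_pow f 0 = conv_one"
| "conv_pow f (Suc n) = conv f (conv_pow f n)"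

lemma conv_infinite: "infinite Q \<Longrightarrow> conv f g Q = 0"
  unfolding conv_def by (rule sum.infinite) simp

lemma conv_empty: "conv f g {} = f {} * g {}"
  by (simp add: conv_def)

lemma conv_cong:
  assumes "\<And>A. A \<subseteq> P \<Longrightarrow> f A = f' A" "\<And>A. A \<subseteq> P \<Longrightarrow> g A = g' A"
  shows "conv f g P = conv f' g' P"
  unfolding conv_def using assms by (intro sum.cong) auto

lemma conv_commute: "conv f g = conv g f"
proof
  fix Q
  show "conv f g Q = conv g f Q"
    unfolding conv_def
    by (rule sum.reindex_bij_witness[of _ "\<lambda>P. Q - P" "\<lambda>P. Q - P"])
       (auto simp: double_diff mult.commute)
qed

lemma conv_assoc: "conv (conv f g) h = conv f (conv g h)"
proof
  fix Q
  show "conv (conv f g) h Q = conv f (conv g h) Q"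
  proof (cases "finite Q")
    case False
    then show ?thesis by (simp add: conv_infinite)
  next
    case True
    have fin: "\<And>P. P \<subseteq> Q \<Longrightarrow> finite P" using True finite_subset by blast
    have "conv (conv f g) h Q = (\<Sum>P\<in>Pow Q. \<Sum>S\<in>Pow P. f S * g (P - S) * h (Q - P))"
      by (simp add: conv_def sum_distrib_right)
    also have "\<dots> = (\<Sum>(P, S)\<in>Sigma (Pow Q) Pow. f S * g (P - S) * h (Q - P))"
      by (rule sum.Sigma) (auto simp: True fin)
    \<comment> \<open>A chain \<open>S \<subseteq> P \<subseteq> Q\<close> amounts to a pair of
      disjoint subsets \<open>S\<close> and \<open>U = P - S\<close> of \<open>Q\<close>.\<close>
    also have "\<dots> = (\<Sum>(S, U)\<in>Sigma (Pow Q) (\<lambda>S. Pow (Q - S)). f S * (g U * h (Q - S - U)))"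
      by (rule sum.reindex_bij_witness[of _ "\<lambda>(S, U). (S \<union> U, S)" "\<lambda>(P, S). (S, P - S)"])
         (auto simp: mult.assoc Un_Diff Un_absorb1 Diff_triv intro!: arg_cong[of _ _ h])
    also have "\<dots> = (\<Sum>S\<in>Pow Q. \<Sum>U\<in>Pow (Q - S). f S * (g U * h (Q - S - U)))"
      by (rule sum.Sigma[symmetric]) (auto simp: True)
    also have "\<dots> = conv f (conv g h) Q"
      by (simp add: conv_def sum_distrib_left)
    finally show ?thesis .
  qed
qed

lemma conv_add_left: "conv (\<lambda>P. f P + f' P) g Q = conv f g Q + conv f' g Q"
  by (simp add: conv_def sum.distrib algebra_simps)

lemma conv_scale_left: "conv (\<lambda>P. c * f P) g Q = c * conv f g Q"
  by (simp add: conv_def sum_distrib_left algebra_simps)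

lemma conv_minus_left: "conv (\<lambda>P. - f P) g Q = - conv f g Q"
  by (simp add: conv_def sum_negf)

lemma conv_one_left:
  assumes "finite P"
  shows "conv conv_one f P = f P"
proof -
  have "conv conv_one f P = (\<Sum>A\<in>Pow P. if A = {} then f P else 0)"
    unfolding conv_def conv_one_def by (intro sum.cong) auto
  then show ?thesis using assms by simp
qed

lemma conv_pow_square: "conv_pow (conv g g) n = conv_pow g (2 * n)"
  by (induction n) (auto simp: conv_assoc)

lemma conv_pow_empty: "conv_pow g n {} = g {} ^ n"
  by (induction n) (auto simp: conv_empty conv_one_def)

text \<open>A subset of \<open>P \<union> B\<close> splits uniquely into its traces on
  \<open>P\<close> and \<open>B\<close>. This is the Leibniz rule for translation by
  \<open>B\<close>; for a singleton \<open>B\<close> translation acts as a derivation.\<close>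

lemma conv_union:
  assumes "finite P" "finite B" "P \<inter> B = {}"
  shows "conv f g (P \<union> B) = (\<Sum>C\<in>Pow B. conv (\<lambda>A. f (A \<union> C)) (\<lambda>A. g (A \<union> (B - C))) P)"
proof -
  have "(\<Sum>C\<in>Pow B. conv (\<lambda>A. f (A \<union> C)) (\<lambda>A. g (A \<union> (B - C))) P)
      = (\<Sum>(C, A)\<in>Pow B \<times> Pow P. f (A \<union> C) * g ((P - A) \<union> (B - C)))"
    unfolding conv_def by (rule sum.Sigma) (auto simp: assms)
  also have "\<dots> = (\<Sum>D\<in>Pow (P \<union> B). f D * g (P \<union> B - D))"
  proof (rule sum.reindex_bij_witness[of _ "\<lambda>D. (D \<inter> B, D \<inter> P)" "\<lambda>(C, A). A \<union> C"], goal_cases)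
    case (5 a)
    then obtain C A where a: "a = (C, A)" "C \<subseteq> B" "A \<subseteq> P" by auto
    have "P \<union> B - (A \<union> C) = (P - A) \<union> (B - C)" using assms(3) a by blast
    then show ?case using a by simp
  qed (use assms(3) in auto)
  finally show ?thesis by (simp add: conv_def)
qed

section \<open>Finite sets avoiding a finite set, and thin maps\<close>

definition off_finite :: "'a set filter" where
  "off_finite = (INF T\<in>{T. finite T}. principal {P. finite P \<and> P \<inter> T = {}})"

lemma eventually_off_finite:
  "eventually \<phi> off_finite \<longleftrightarrow> (\<exists>T. finite T \<and> (\<forall>P. finite P \<and> P \<inter> T = {} \<longrightarrow> \<phi> P))"
proof -
  have "eventually \<phi> off_finite \<longleftrightarrow>
      (\<exists>T\<in>{T. finite T}. eventually \<phi> (principal {P. finite P \<and> P \<inter> T = {}}))"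
    unfolding off_finite_def
  proof (rule eventually_INF_base)
    fix S T :: "'a set"
    assume "S \<in> {T. finite T}" "T \<in> {T. finite T}"
    then show "\<exists>U\<in>{T. finite T}. principal {P. finite P \<and> P \<inter> U = {}}
        \<le> inf (principal {P. finite P \<and> P \<inter> S = {}}) (principal {P. finite P \<and> P \<inter> T = {}})"
      by (intro bexI[of _ "S \<union> T"]) auto
  qed auto
  then show ?thesis by (auto simp: eventually_principal)
qed

abbreviation thin :: "('a set \<Rightarrow> 'k::field) \<Rightarrow> bool" where
  "thin f \<equiv> eventually (\<lambda>P. f P = 0) off_finite"

lemma eventually_off_finite_at_empty: "eventually \<phi> off_finite \<Longrightarrow> \<phi> {}"
  by (auto simp: eventually_off_finite)

lemma eventually_off_finite_finite_disjoint:
  "finite B \<Longrightarrow> eventually (\<lambda>P. finite P \<and> P \<inter> B = {}) off_finite"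
  by (auto simp: eventually_off_finite)

text \<open>Convolution at \<open>P\<close> reads its factors at all subsets of \<open>P\<close>, so
  facts about a factor are needed on all of these at once. Avoiding \<open>T\<close> passes to
  subsets.\<close>

lemma eventually_off_finite_subsets:
  assumes "eventually \<phi> off_finite"
  shows "eventually (\<lambda>P. \<forall>A\<subseteq>P. \<phi> A) off_finite"
proof -
  obtain T where T: "finite T" "\<And>P. finite P \<Longrightarrow> P \<inter> T = {} \<Longrightarrow> \<phi> P"
    using assms by (auto simp: eventually_off_finite)
  have "\<phi> A" if "finite P" "P \<inter> T = {}" "A \<subseteq> P" for A P
    using that T(2)[of A] finite_subset by blast
  then show ?thesis using T(1) by (auto simp: eventually_off_finite)
qed

text \<open>\<open>T\<close> is named rather than hidden in an \<open>eventually\<close> hypothesis,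
  because \<open>B\<close> has to avoid that same \<open>T\<close>.\<close>

lemma eventually_off_finite_union:
  assumes "finite T" "\<And>P. finite P \<Longrightarrow> P \<inter> T = {} \<Longrightarrow> \<phi> P" "finite B" "B \<inter> T = {}"
  shows "eventually (\<lambda>P. \<phi> (P \<union> B)) off_finite"
proof -
  have "\<phi> (P \<union> B)" if "finite P" "P \<inter> T = {}" for P
    by (rule assms(2)) (use that assms in auto)
  then show ?thesis using assms(1) by (auto simp: eventually_off_finite)
qed

lemma thin_conv_left:
  assumes "thin f"
  shows "thin (conv f g)"
  using eventually_off_finite_subsets[OF assms]
  by eventually_elim (auto simp: conv_def intro!: sum.neutral)

lemma thin_conv_right: "thin g \<Longrightarrow> thin (conv f g)"
  using thin_conv_left[of g f] by (simp add: conv_commute)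

text \<open>The summand of \<open>{}\<close> isolates \<open>f {} * g P\<close>; all others involve
  \<open>g\<close> at proper subsets of \<open>P\<close>, so induction on \<open>P\<close>
  applies.\<close>

lemma thin_of_conv_unit:
  fixes f g :: "'a set \<Rightarrow> 'k::field"
  assumes "f {} \<noteq> 0" "thin (conv f g)"
  shows "thin g"
proof -
  obtain T where T: "finite T" "\<And>P. finite P \<Longrightarrow> P \<inter> T = {} \<Longrightarrow> conv f g P = 0"
    using assms(2) by (auto simp: eventually_off_finite)
  have "g P = 0" if "finite P" "P \<inter> T = {}" for P
    using that
  proof (induction P rule: finite_psubset_induct)
    case (psubset P)
    have "g (P - A) = 0" if "A \<in> Pow P - {{}}" for A
      by (rule psubset.IH) (use that psubset.prems in auto)
    then have "conv f g P = f {} * g P"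
      unfolding conv_def using psubset.hyps
      by (subst sum.remove[of _ "{}"]) auto
    then show ?case using T(2)[of P] psubset assms(1) by simp
  qed
  then show ?thesis using T(1) by (auto simp: eventually_off_finite)
qed

section \<open>Zero divisors are nilpotent modulo thin maps\<close>

text \<open>Each induction step takes a point \<open>x\<close> out of \<open>A\<close>, replacing
  \<open>f\<close> by its translate, \<open>g\<close> by its square and \<open>T\<close> by
  \<open>insert x T\<close>. The exponent reached is two to the power \<open>card A\<close>.\<close>

lemma zero_divisor_nilpotent:
  fixes f g :: "'a set \<Rightarrow> 'k::field"
  assumes "finite A" "A \<inter> T = {}" "finite T" "f A \<noteq> 0"
    and "\<And>P. finite P \<Longrightarrow> P \<inter> T = {} \<Longrightarrow> conv f g P = 0"
  shows "\<exists>n. thin (conv_pow g n)"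
  using assms
proof (induction A arbitrary: f g T)
  case empty
  have "thin (conv f g)" using empty by (auto simp: eventually_off_finite)
  then have "thin g" using empty thin_of_conv_unit by blast
  then have "thin (conv_pow g 1)" by (simp add: thin_conv_left)
  then show ?case by blast
next
  case (insert x A)
  define f' where "f' = (\<lambda>P. f (P \<union> {x}))"
  define g' where "g' = (\<lambda>P. g (P \<union> {x}))"
  have leib: "conv f' g P = - conv f g' P" if "finite P" "P \<inter> insert x T = {}" for P
  proof -
    have "conv f g (P \<union> {x}) = 0"
      by (rule insert.prems(4)) (use that insert.prems in auto)
    moreover have "conv f g (P \<union> {x}) = conv f g' P + conv f' g P"
      using that by (subst conv_union) (auto simp: f'_def g'_def Pow_insert)
    ultimately show ?thesis by (simp add: eq_neg_iff_add_eq_0 add.commute)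
  qed
  \<comment> \<open>Multiplying the one-point Leibniz rule by \<open>g\<close> turns
    \<open>f' g g\<close> into \<open>- (f g) g'\<close>, and \<open>f g\<close> vanishes on all
    subsets of \<open>P\<close>.\<close>
  have zero: "conv f' (conv g g) P = 0" if P: "finite P" "P \<inter> insert x T = {}" for P
  proof -
    have sub: "finite B" "B \<inter> insert x T = {}" "B \<inter> T = {}" if "B \<subseteq> P" for B
      using that P finite_subset by blast+
    have "conv f' (conv g g) P = conv (conv f' g) g P"
      by (simp add: conv_assoc)
    also have "\<dots> = conv (\<lambda>B. - conv f g' B) g P"
      using leib sub by (intro conv_cong) auto
    also have "\<dots> = - conv (conv f g) g' P"
      by (simp add: conv_minus_left conv_assoc conv_commute[of g g'])
    also have "conv (conv f g) g' P = conv (\<lambda>_. 0) g' P"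
      using insert.prems(4) sub by (intro conv_cong) auto
    also have "\<dots> = 0" by (simp add: conv_def)
    finally show ?thesis by simp
  qed
  have "\<exists>n. thin (conv_pow (conv g g) n)"
    by (rule insert.IH[of "insert x T" f']) (use insert zero in \<open>auto simp: f'_def\<close>)
  then show ?case by (auto simp: conv_pow_square)
qed

section \<open>The Leibniz rule modulo thin maps, and cancellation\<close>

text \<open>Each of the finitely many terms with \<open>C\<close> other than \<open>{}\<close> and
  \<open>B\<close> contains a thin translate of \<open>f\<close>. Thinness is asked of the first
  factor, so that the second may be a power of it.\<close>

lemma leibniz_mod_thin:
  fixes f g :: "'a set \<Rightarrow> 'k::field"
  assumes "finite B" "B \<noteq> {}"
    and thin: "\<And>C. C \<noteq> {} \<Longrightarrow> C \<subset> B \<Longrightarrow> thin (\<lambda>P. f (P \<union> C))"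
  shows "eventually (\<lambda>P. conv f g (P \<union> B) =
           conv (\<lambda>P. f (P \<union> B)) g P + conv f (\<lambda>P. g (P \<union> B)) P) off_finite"
proof -
  let ?t = "\<lambda>C. conv (\<lambda>A. f (A \<union> C)) (\<lambda>A. g (A \<union> (B - C)))"
  have "eventually (\<lambda>P. \<forall>C\<in>Pow B - {{}, B}. ?t C P = 0) off_finite"
    by (rule eventually_ball_finite) (use assms(1) thin in \<open>auto intro!: thin_conv_left\<close>)
  moreover have "eventually (\<lambda>P. finite P \<and> P \<inter> B = {}) off_finite"
    using assms(1) by (rule eventually_off_finite_finite_disjoint)
  ultimately show ?thesis
  proof eventually_elim
    case (elim P)
    have "conv f g (P \<union> B) = (\<Sum>C\<in>Pow B. ?t C P)"
      using elim assms by (intro conv_union) auto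
    also have "\<dots> = (\<Sum>C\<in>{{}, B}. ?t C P)"
      using elim assms by (intro sum.mono_neutral_right) auto
    finally show ?case using assms(2) by (simp add: add.commute)
  qed
qed

text \<open>The analogue of the power rule \<open>(g^(n+1))' = (n+1) g^n g'\<close>.\<close>

lemma conv_pow_leibniz_mod_thin:
  fixes g :: "'a set \<Rightarrow> 'k::field"
  assumes "finite B" "B \<noteq> {}"
    and thin: "\<And>C. C \<noteq> {} \<Longrightarrow> C \<subset> B \<Longrightarrow> thin (\<lambda>P. g (P \<union> C))"
  shows "eventually (\<lambda>P. conv_pow g (Suc n) (P \<union> B) =
           of_nat (Suc n) * conv (conv_pow g n) (\<lambda>P. g (P \<union> B)) P) off_finite"
proof (induction n)
  case 0
  have "eventually (\<lambda>P. finite P \<and> P \<inter> B = {}) off_finite"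
    using assms(1) by (rule eventually_off_finite_finite_disjoint)
  then show ?case
    by eventually_elim (simp add: assms(1) conv_commute[of g] conv_one_left)
next
  case (Suc n)
  let ?g' = "\<lambda>P. g (P \<union> B)"
  have "eventually (\<lambda>P. conv g (conv_pow g (Suc n)) (P \<union> B) =
           conv ?g' (conv_pow g (Suc n)) P + conv g (\<lambda>P. conv_pow g (Suc n) (P \<union> B)) P) off_finite"
    using assms by (rule leibniz_mod_thin)
  then show ?case
    \<comment> \<open>The induction hypothesis is applied inside a convolution with
      \<open>g\<close>, hence on all subsets of \<open>P\<close>.\<close>
    using eventually_off_finite_subsets[OF Suc]
  proof eventually_elim
    case (elim P)
    have "conv g (\<lambda>P. conv_pow g (Suc n) (P \<union> B)) P
        = conv (\<lambda>P. of_nat (Suc n) * conv (conv_pow g n) ?g' P) g P"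
      unfolding conv_commute[of g "\<lambda>P. conv_pow g (Suc n) (P \<union> B)"]
      using elim(2) by (intro conv_cong) blast+
    also have "\<dots> = of_nat (Suc n) * conv (conv_pow g (Suc n)) ?g' P"
      unfolding conv_scale_left by (simp add: conv_commute[of _ g] conv_assoc)
    finally have "conv_pow g (Suc (Suc n)) (P \<union> B)
        = conv ?g' (conv_pow g (Suc n)) P + of_nat (Suc n) * conv (conv_pow g (Suc n)) ?g' P"
      using elim(1) by simp
    then show ?case
      by (simp add: conv_commute[of ?g'] algebra_simps)
  qed
qed

text \<open>Induction on the degree bound of \<open>g\<close>. The induction hypothesis cancels a
  translate of \<open>g\<close> from a product with a power of \<open>g\<close>, so both maps have
  to be arbitrary.\<close>

theorem thin_of_thin_conv:
  fixes f g :: "'a set \<Rightarrow> 'k::field_char_0"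
  assumes "eventually (\<lambda>P. n \<le> card P \<longrightarrow> g P = 0) off_finite"
    and "\<not> thin g" "thin (conv f g)"
  shows "thin f"
  using assms
proof (induction n arbitrary: f g)
  case 0
  then show ?case by simp
next
  case (Suc n)
  note IH = Suc.IH and prems = Suc.prems
  \<comment> \<open>Inner induction on the exponent: if \<open>g^(m+1)\<close> is thin, so is the
    product of \<open>g^m\<close> with a translate of \<open>g\<close> that is not thin and has a
    smaller degree bound; cancelling the translate makes \<open>g^m\<close> thin.\<close>
  have not_nilpotent: "\<not> thin (conv_pow g m)" for m
  proof (induction m)
    case 0
    show ?case
      using eventually_off_finite_at_empty[of "\<lambda>P. conv_one P = (0::'k)"]
      by (fastforce simp: conv_one_def)
  next
    case (Suc m)
    show ?case
    proof
      assume "thin (conv_pow g (Suc m))"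
      then have "eventually (\<lambda>P. conv_pow g (Suc m) P = 0 \<and> (Suc n \<le> card P \<longrightarrow> g P = 0)) off_finite"
        using prems(1) by (rule eventually_conj)
      then obtain T where T: "finite T"
        "\<And>P. finite P \<Longrightarrow> P \<inter> T = {} \<Longrightarrow>
          conv_pow g (Suc m) P = 0 \<and> (Suc n \<le> card P \<longrightarrow> g P = 0)"
        unfolding eventually_off_finite by blast
      \<comment> \<open>The value of a power at \<open>{}\<close> is the power of
        \<open>g {}\<close>. Its vanishing makes the set \<open>A\<close> chosen next
        nonempty.\<close>
      have g0: "g {} = 0"
        using T(2)[of "{}"] conv_pow_empty[of g "Suc m"] by (auto simp del: conv_pow.simps)
      obtain A where A: "finite A" "A \<inter> T = {}" "g A \<noteq> 0"
        using prems(2) T(1) unfolding eventually_off_finite by blast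
      \<comment> \<open>Candidates avoid \<open>T\<close>, so that what holds on sets avoiding
        \<open>T\<close> can be translated by them. For a candidate of least size, the translates by
        its nonempty proper subsets are thin.\<close>
      define bad where
        "bad B \<longleftrightarrow> finite B \<and> B \<inter> T = {} \<and> B \<noteq> {} \<and> \<not> thin (\<lambda>P. g (P \<union> B))" for B
      have "bad A"
        using A g0 eventually_off_finite_at_empty[of "\<lambda>P. g (P \<union> A) = 0"] by (auto simp: bad_def)
      then obtain B where B: "bad B" "\<And>C. bad C \<Longrightarrow> card B \<le> card C"
        using ex_has_least_nat[of bad A card] by blast
      have Bs: "finite B" "B \<inter> T = {}" "B \<noteq> {}" "\<not> thin (\<lambda>P. g (P \<union> B))"
        using B(1) by (auto simp: bad_def)
      have "thin (\<lambda>P. g (P \<union> C))" if "C \<noteq> {}" "C \<subset> B" for C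
      proof (rule ccontr)
        assume "\<not> thin (\<lambda>P. g (P \<union> C))"
        then have "bad C"
          using that Bs finite_subset[of C B] by (auto simp: bad_def)
        then show False
          using B(2)[of C] psubset_card_mono[OF Bs(1) that(2)] by simp
      qed
      then have "eventually (\<lambda>P. conv_pow g (Suc m) (P \<union> B) =
           of_nat (Suc m) * conv (conv_pow g m) (\<lambda>P. g (P \<union> B)) P) off_finite"
        using Bs by (intro conv_pow_leibniz_mod_thin) auto
      moreover have "eventually (\<lambda>P. conv_pow g (Suc m) (P \<union> B) = 0) off_finite"
        using eventually_off_finite_union[OF T(1) _ Bs(1,2), of "\<lambda>P. conv_pow g (Suc m) P = 0"] T(2)
        by blast
      \<comment> \<open>Characteristic zero permits division by
        \<open>of_nat (Suc m)\<close>.\<close>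
      ultimately have "thin (conv (conv_pow g m) (\<lambda>P. g (P \<union> B)))"
        by eventually_elim (simp del: of_nat_Suc)
      moreover have "eventually (\<lambda>P. n \<le> card P \<longrightarrow> g (P \<union> B) = 0) off_finite"
      proof -
        have "eventually (\<lambda>P. Suc n \<le> card (P \<union> B) \<longrightarrow> g (P \<union> B) = 0) off_finite"
          using eventually_off_finite_union[OF T(1) _ Bs(1,2), of "\<lambda>P. Suc n \<le> card P \<longrightarrow> g P = 0"]
            T(2) by blast
        moreover have "eventually (\<lambda>P. finite P \<and> P \<inter> B = {}) off_finite"
          using Bs(1) by (rule eventually_off_finite_finite_disjoint)
        ultimately show ?thesis
        proof eventually_elim
          case (elim P)
          \<comment> \<open>Being nonempty and disjoint from \<open>P\<close>, \<open>B\<close> adds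
            at least one point, which lowers the bound from \<open>Suc n\<close> to
            \<open>n\<close>.\<close>
          have "card B > 0" using Bs by (simp add: card_gt_0_iff)
          then show ?case using elim Bs(1) by (auto simp: card_Un_disjoint)
        qed
      qed
      ultimately have "thin (conv_pow g m)"
        using IH[of "\<lambda>P. g (P \<union> B)" "conv_pow g m"] Bs(4) by blast
      then show False using Suc.IH by simp
    qed
  qed
  show ?case
  proof (rule ccontr)
    assume f: "\<not> thin f"
    obtain T where T: "finite T" "\<And>P. finite P \<Longrightarrow> P \<inter> T = {} \<Longrightarrow> conv f g P = 0"
      using prems(3) by (auto simp: eventually_off_finite)
    obtain A where "finite A" "A \<inter> T = {}" "f A \<noteq> 0"
      using f T(1) unfolding eventually_off_finite by blast
    then show False
      using zero_divisor_nilpotent[of A T f g] T not_nilpotent by blast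
  qed
qed

section \<open>Transversals, and copies avoiding a finite set\<close>

definition transversal :: "'a set \<Rightarrow> 'a set set \<Rightarrow> bool" where
  "transversal T \<F> \<longleftrightarrow> (\<forall>F\<in>\<F>. F \<inter> T \<noteq> {})"

text \<open>Fix a member \<open>F\<close>. A transversal meets \<open>F\<close> in some
  \<open>x\<close>, and its other points meet every member avoiding \<open>x\<close>. These members
  have no transversal of size at most \<open>n\<close>, so induction gives a finite subfamily for
  each of the finitely many \<open>x\<close>.\<close>

lemma finite_subfamily_no_small_transversal:
  assumes "\<And>F. F \<in> \<F> \<Longrightarrow> finite F"
    and "\<And>T. finite T \<Longrightarrow> card T \<le> n \<Longrightarrow> \<not> transversal T \<F>"
  shows "\<exists>\<G>\<subseteq>\<F>. finite \<G> \<and> (\<forall>T. finite T \<and> card T \<le> n \<longrightarrow> \<not> transversal T \<G>)"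
  using assms
proof (induction n arbitrary: \<F>)
  case 0
  obtain F where "F \<in> \<F>" using 0(2)[of "{}"] by (auto simp: transversal_def)
  then show ?case by (intro exI[of _ "{F}"]) (auto simp: transversal_def)
next
  case (Suc n)
  obtain F where F: "F \<in> \<F>" using Suc.prems(2)[of "{}"] by (auto simp: transversal_def)
  have "\<exists>\<G>\<subseteq>{H\<in>\<F>. x \<notin> H}. finite \<G> \<and> (\<forall>T. finite T \<and> card T \<le> n \<longrightarrow> \<not> transversal T \<G>)" for x
  proof (rule Suc.IH)
    fix T :: "'a set" assume T: "finite T" "card T \<le> n"
    have "card (insert x T) \<le> Suc n" using T by (simp add: card_insert_if)
    then have "\<not> transversal (insert x T) \<F>" using Suc.prems(2) T by simp
    then show "\<not> transversal T {H\<in>\<F>. x \<notin> H}" by (auto simp: transversal_def)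
  qed (use Suc.prems in auto)
  then obtain \<G> where G: "\<And>x. \<G> x \<subseteq> {H\<in>\<F>. x \<notin> H}" "\<And>x. finite (\<G> x)"
    "\<And>x T. finite T \<Longrightarrow> card T \<le> n \<Longrightarrow> \<not> transversal T (\<G> x)"
    by metis
  have "\<not> transversal T (insert F (\<Union>x\<in>F. \<G> x))" if T: "finite T" "card T \<le> Suc n" for T
  proof
    assume tr: "transversal T (insert F (\<Union>x\<in>F. \<G> x))"
    then obtain x where x: "x \<in> F" "x \<in> T" by (auto simp: transversal_def)
    then have "\<not> transversal (T - {x}) (\<G> x)"
      using T by (intro G(3)) auto
    then obtain H where "H \<in> \<G> x" "H \<inter> (T - {x}) = {}" by (auto simp: transversal_def)
    moreover have "H \<inter> T \<noteq> {}" "x \<notin> H"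
      using \<open>H \<in> \<G> x\<close> G(1)[of x] tr x by (auto simp: transversal_def)
    ultimately show False by blast
  qed
  moreover have "insert F (\<Union>x\<in>F. \<G> x) \<subseteq> \<F>" using F G(1) by blast
  moreover have "finite (insert F (\<Union>x\<in>F. \<G> x))" using Suc.prems(1)[OF F] G(2) by auto
  ultimately show ?case by blast
qed

lemma relational_structure_induced:
  assumes "relational_structure R"
  shows "relational_structure (induced R A)"
  using assms unfolding relational_structure_def induced_def by fastforce

lemma induced_induced: "B \<subseteq> A \<Longrightarrow> induced (induced R A) B = induced R B"
  by (auto simp: induced_def intro!: arg_cong[of _ _ "\<lambda>r. R\<lparr>universe := B, rels := r\<rparr>"])

text \<open>A single \<open>h\<close> serves all subsets of \<open>F\<close>, which allows copies to
  be transported inside a larger set and products to be reindexed.\<close>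

lemma age_equivE:
  assumes "age_equiv R F F'"
  obtains h where "bij_betw h F F'" "\<And>P. P \<subseteq> F \<Longrightarrow> age_equiv R P (h ` P)"
proof -
  obtain h where h: "bij_betw h F F'"
    and r: "\<And>i xs. i \<in> index_set R \<Longrightarrow> length xs = arity R i \<Longrightarrow> set xs \<subseteq> F \<Longrightarrow>
       xs \<in> rels (induced R F) i \<longleftrightarrow> map h xs \<in> rels (induced R F') i"
    using assms unfolding age_equiv_def rel_isomorphic_def by (auto simp: induced_def)
  have "age_equiv R P (h ` P)" if P: "P \<subseteq> F" for P
  proof -
    have "bij_betw h P (h ` P)" using h P bij_betw_subset by blast
    moreover have "xs \<in> rels (induced R P) i \<longleftrightarrow> map h xs \<in> rels (induced R (h ` P)) i"
      if "i \<in> index_set R" "length xs = arity R i" "set xs \<subseteq> P" for i xs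
    proof -
      have "h ` P \<subseteq> F'" using h P by (auto simp: bij_betw_def)
      then show ?thesis using r[of i xs] that P by (auto simp: induced_def)
    qed
    ultimately show ?thesis
      unfolding age_equiv_def rel_isomorphic_def by (auto simp: induced_def)
  qed
  then show thesis using h that by blast
qed

text \<open>With empty kernel, deleting \<open>x\<close> leaves the age unchanged, so the type of
  \<open>G\<close> still occurs in what remains.\<close>

lemma age_equiv_avoiding_point:
  assumes "relational_structure R" "rel_kernel R = {}" "G \<in> Fpow (universe R)"
  obtains G' where "G' \<in> Fpow (universe R)" "x \<notin> G'" "age_equiv R G G'"
proof (cases "x \<in> universe R")
  case False
  then show thesis
    using that[of G] assms(3) rel_isomorphic_refl by (auto simp: Fpow_def age_equiv_def)
next
  case True
  let ?S = "induced R (universe R - {x})"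
  have "age ?S = age R" using True assms(2) by (auto simp: rel_kernel_def)
  then have "iso_type (induced R G) \<in> age ?S" using assms(3) by (auto simp: age_def)
  then obtain G' where G': "G' \<in> Fpow (universe ?S)"
    "iso_type (induced R G) = iso_type (induced ?S G')"
    by (auto simp: age_def)
  have sub: "G' \<subseteq> universe R - {x}" "finite G'" using G' by (auto simp: Fpow_def induced_def)
  then have "rel_isomorphic (induced R G) (induced R G')"
    using G'(2) iso_type_eq_iff relational_structure_induced[OF assms(1)]
    by (metis induced_induced)
  then show thesis using that[of G'] sub by (auto simp: Fpow_def age_equiv_def)
qed

lemma age_equiv_avoiding_finite:
  assumes "relational_structure R" "rel_kernel R = {}" "F \<in> Fpow (universe R)" "finite T"
  obtains F' where "F' \<in> Fpow (universe R)" "F' \<inter> T = {}" "age_equiv R F F'"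
proof -
  define \<F> where "\<F> = {F' \<in> Fpow (universe R). age_equiv R F F'}"
  have FF: "F \<in> \<F>" using assms(3) by (auto simp: \<F>_def age_equiv_def rel_isomorphic_refl)
  have "\<not> transversal T \<F>"
  proof
    assume "transversal T \<F>"
    \<comment> \<open>From here on \<open>T\<close> is a transversal of least size instead of the
      given set.\<close>
    then obtain T where T: "finite T" "transversal T \<F>"
      and min: "\<And>S. finite S \<Longrightarrow> transversal S \<F> \<Longrightarrow> card T \<le> card S"
      using ex_has_least_nat[of "\<lambda>T. finite T \<and> transversal T \<F>" T card] assms(4) by blast
    obtain x where x: "x \<in> T" using T FF by (auto simp: transversal_def)
    then have pos: "card T > 0" using T card_gt_0_iff by blast
    have "\<exists>\<G>\<subseteq>\<F>. finite \<G> \<and> (\<forall>S. finite S \<and> card S \<le> card T - 1 \<longrightarrow> \<not> transversal S \<G>)"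
    proof (rule finite_subfamily_no_small_transversal)
      show "finite F" if "F \<in> \<F>" for F using that by (auto simp: \<F>_def Fpow_def)
      show "\<not> transversal S \<F>" if "finite S" "card S \<le> card T - 1" for S
        using min[of S] that pos by linarith
    qed
    then obtain \<G> where G: "\<G> \<subseteq> \<F>" "finite \<G>"
      "\<And>S. finite S \<Longrightarrow> card S \<le> card T - 1 \<Longrightarrow> \<not> transversal S \<G>"
      by blast
    have "\<Union>\<G> \<in> Fpow (universe R)" using G by (auto simp: \<F>_def Fpow_def)
    then obtain G' where G': "G' \<in> Fpow (universe R)" "x \<notin> G'" "age_equiv R (\<Union>\<G>) G'"
      using age_equiv_avoiding_point[OF assms(1,2)] by blast
    obtain h where h: "bij_betw h (\<Union>\<G>) G'" "\<And>P. P \<subseteq> \<Union>\<G> \<Longrightarrow> age_equiv R P (h ` P)"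
      using age_equivE[OF G'(3)] by blast
    \<comment> \<open>Pulling \<open>T\<close> back along \<open>h\<close> loses the point
      \<open>x\<close>, so \<open>S\<close> is too small to meet every member of
      \<open>\<G>\<close>.\<close>
    define S where "S = inv_into (\<Union>\<G>) h ` (T \<inter> G')"
    have "card S \<le> card (T \<inter> G')" unfolding S_def using T by (intro card_image_le) auto
    also have "\<dots> \<le> card (T - {x})" using T G'(2) by (intro card_mono) auto
    also have "\<dots> = card T - 1" using x by simp
    finally have "\<not> transversal S \<G>" using G(3) T by (simp add: S_def)
    then obtain H where H: "H \<in> \<G>" "H \<inter> S = {}" by (auto simp: transversal_def)
    \<comment> \<open>The image of \<open>H\<close> is again a copy of \<open>F\<close> and so meets
      \<open>T\<close>; the preimage of a common point then lies in both \<open>H\<close> and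
      \<open>S\<close>.\<close>
    have "age_equiv R F H" using H G by (auto simp: \<F>_def)
    moreover have "age_equiv R H (h ` H)" using H h(2) by blast
    ultimately have "age_equiv R F (h ` H)"
      unfolding age_equiv_def by (rule rel_isomorphic_trans)
    moreover have hH: "h ` H \<subseteq> G'" using h(1) H by (auto simp: bij_betw_def)
    moreover have "finite (h ` H)" using hH G'(1) finite_subset by (auto simp: Fpow_def)
    ultimately have "h ` H \<in> \<F>" using G'(1) by (auto simp: \<F>_def Fpow_def)
    then have "h ` H \<inter> T \<noteq> {}" using T(2) by (simp add: transversal_def)
    then obtain y where y: "y \<in> H" "h y \<in> T" by blast
    have "inv_into (\<Union>\<G>) h (h y) = y"
      using h(1) y(1) H(1) by (intro inv_into_f_f) (auto simp: bij_betw_def)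
    then have "y \<in> S" unfolding S_def using y hH by force
    then show False using H y by blast
  qed
  then show thesis using that by (auto simp: transversal_def \<F>_def)
qed

section \<open>The age algebra as a commutative ring without zero divisors\<close>

lemma carrier_set_algebra:
  "f \<in> carrier (set_algebra E) \<longleftrightarrow>
     (\<forall>P. P \<notin> Fpow E \<longrightarrow> f P = 0) \<and> (\<exists>n. \<forall>P\<in>Fpow E. card P \<ge> n \<longrightarrow> f P = 0)"
  by (simp add: set_algebra_def)

lemma carrier_age_algebra:
  "f \<in> carrier (age_algebra R) \<longleftrightarrow> f \<in> carrier (set_algebra (universe R)) \<and>
     (\<forall>F\<in>Fpow (universe R). \<forall>F'\<in>Fpow (universe R). age_equiv R F F' \<longrightarrow> f F = f F')"
  by (simp add: age_algebra_def)

lemma age_algebra_simps [simp]: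
  "monoid.mult (age_algebra R) = conv"
  "one (age_algebra R) = conv_one"
  "zero (age_algebra R) = (\<lambda>P. 0)"
  "add (age_algebra R) = (\<lambda>f g P. f P + g P)"
  by (auto simp: age_algebra_def set_algebra_def conv_def conv_one_def fun_eq_iff)

text \<open>Degree bounds add, since \<open>card P + card (Q - P) = card Q\<close> for finite
  \<open>Q\<close>.\<close>

lemma conv_in_set_algebra:
  assumes "f \<in> carrier (set_algebra E)" "g \<in> carrier (set_algebra E)"
  shows "conv f g \<in> carrier (set_algebra E)"
proof -
  obtain m n where m: "\<And>P. P \<in> Fpow E \<Longrightarrow> m \<le> card P \<Longrightarrow> f P = 0"
    and n: "\<And>P. P \<in> Fpow E \<Longrightarrow> n \<le> card P \<Longrightarrow> g P = 0"
    using assms unfolding carrier_set_algebra by meson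
  have z: "f P = 0" "g P = 0" if "P \<notin> Fpow E" for P
    using assms that by (auto simp: carrier_set_algebra)
  have "conv f g Q = 0" if "Q \<notin> Fpow E" for Q
    unfolding conv_def
  proof (rule sum.neutral, rule ballI)
    fix P assume "P \<in> Pow Q"
    then have "P \<union> (Q - P) = Q" by blast
    then have "P \<notin> Fpow E \<or> Q - P \<notin> Fpow E"
      using that by (auto simp: Fpow_def dest: finite_UnI)
    then show "f P * g (Q - P) = 0" using z by auto
  qed
  moreover have "conv f g Q = 0" if "Q \<in> Fpow E" "m + n \<le> card Q" for Q
    unfolding conv_def
  proof (rule sum.neutral, rule ballI)
    fix P assume "P \<in> Pow Q"
    then have P: "P \<in> Fpow E" "Q - P \<in> Fpow E" "card Q = card P + card (Q - P)"
      using that by (auto simp: Fpow_def card_Diff_subset card_mono finite_subset)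
    then have "m \<le> card P \<or> n \<le> card (Q - P)" using that by linarith
    then show "f P * g (Q - P) = 0" using m n P by auto
  qed
  ultimately show ?thesis unfolding carrier_set_algebra by blast
qed

text \<open>An isomorphism from \<open>F\<close> to \<open>F'\<close> maps the subsets of
  \<open>F\<close> bijectively to those of \<open>F'\<close>, respecting complements and
  equivalence, so the two sums agree term by term.\<close>

lemma conv_in_age_algebra:
  assumes "f \<in> carrier (age_algebra R)" "g \<in> carrier (age_algebra R)"
  shows "conv f g \<in> carrier (age_algebra R)"
proof -
  have "conv f g F = conv f g F'"
    if F: "F \<in> Fpow (universe R)" "F' \<in> Fpow (universe R)" "age_equiv R F F'" for F F'
  proof -
    obtain h where h: "bij_betw h F F'" "\<And>P. P \<subseteq> F \<Longrightarrow> age_equiv R P (h ` P)"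
      using age_equivE[OF F(3)] by blast
    have inv: "f P = f (h ` P)" "g P = g (h ` P)" if "P \<subseteq> F" for P
    proof -
      have "h ` P \<subseteq> F'" using h(1) that by (auto simp: bij_betw_def)
      then have "P \<in> Fpow (universe R)" "h ` P \<in> Fpow (universe R)"
        using F(1,2) that by (auto simp: Fpow_def intro: finite_subset)
      then show "f P = f (h ` P)" "g P = g (h ` P)"
        using assms h(2)[OF that] unfolding carrier_age_algebra by blast+
    qed
    have "conv f g F' = (\<Sum>P\<in>Pow F. f (h ` P) * g (F' - h ` P))"
      unfolding conv_def using bij_betw_Pow[OF h(1)]
      by (rule sum.reindex_bij_betw[symmetric])
    also have "\<dots> = conv f g F"
      unfolding conv_def
    proof (rule sum.cong)
      fix P assume P: "P \<in> Pow F"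
      then have "F' - h ` P = h ` (F - P)"
        using h(1) inj_on_image_set_diff[of h F F P] by (auto simp: bij_betw_def)
      then show "f (h ` P) * g (F' - h ` P) = f P * g (F - P)"
        using P inv(1)[of P] inv(2)[of "F - P"] by simp
    qed simp
    finally show ?thesis by simp
  qed
  then show ?thesis using assms conv_in_set_algebra by (auto simp: carrier_age_algebra)
qed

lemma cring_age_algebra: "cring (age_algebra R :: ('k::field, 'a set \<Rightarrow> 'k) module)"
proof (rule cringI)
  let ?A = "age_algebra R :: ('k, 'a set \<Rightarrow> 'k) module"
  show "abelian_group ?A"
  proof (rule abelian_groupI)
    fix f g assume "f \<in> carrier ?A" "g \<in> carrier ?A"
    moreover have "\<exists>n. \<forall>P\<in>Fpow (universe R). n \<le> card P \<longrightarrow> f P + g P = 0"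
      if "\<forall>P\<in>Fpow (universe R). m \<le> card P \<longrightarrow> f P = 0"
         "\<forall>P\<in>Fpow (universe R). n \<le> card P \<longrightarrow> g P = 0" for m n
      using that by (intro exI[of _ "max m n"]) auto
    ultimately show "f \<oplus>\<^bsub>?A\<^esub> g \<in> carrier ?A"
      by (auto simp: carrier_age_algebra carrier_set_algebra)
  next
    show "\<zero>\<^bsub>?A\<^esub> \<in> carrier ?A" by (auto simp: carrier_age_algebra carrier_set_algebra)
  next
    fix f assume "f \<in> carrier ?A"
    then show "\<exists>g\<in>carrier ?A. g \<oplus>\<^bsub>?A\<^esub> f = \<zero>\<^bsub>?A\<^esub>"
      by (intro bexI[of _ "\<lambda>P. - f P"]) (auto simp: carrier_age_algebra carrier_set_algebra)
  qed (auto simp: algebra_simps)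
  show "comm_monoid ?A"
  proof (rule comm_monoidI)
    \<comment> \<open>Since \<open>{}\<close> is equivalent only to itself, the unit is constant on
      classes.\<close>
    have "(F = {}) = (F' = {})" if "age_equiv R F F'" for F F'
      using age_equivE[OF that] by (metis bij_betw_empty1 bij_betw_empty2)
    then show "\<one>\<^bsub>?A\<^esub> \<in> carrier ?A"
      by (auto simp: carrier_age_algebra carrier_set_algebra conv_one_def Fpow_def card_eq_0_iff
          intro!: exI[of _ 1])
    fix f assume f: "f \<in> carrier ?A"
    show "\<one>\<^bsub>?A\<^esub> \<otimes>\<^bsub>?A\<^esub> f = f"
    proof
      fix P
      show "(\<one>\<^bsub>?A\<^esub> \<otimes>\<^bsub>?A\<^esub> f) P = f P"
        using f by (cases "finite P")
          (auto simp: conv_one_left conv_infinite carrier_age_algebra carrier_set_algebra Fpow_def)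
    qed
  qed (auto simp: conv_assoc conv_in_age_algebra intro: conv_commute[THEN fun_cong])
  fix f g h assume "f \<in> carrier ?A" "g \<in> carrier ?A" "h \<in> carrier ?A"
  show "(f \<oplus>\<^bsub>?A\<^esub> g) \<otimes>\<^bsub>?A\<^esub> h = f \<otimes>\<^bsub>?A\<^esub> h \<oplus>\<^bsub>?A\<^esub> g \<otimes>\<^bsub>?A\<^esub> h"
    by (simp add: conv_add_left fun_eq_iff)
qed

text \<open>A set where \<open>f\<close> is nonzero has a copy avoiding any given finite
  \<open>T\<close>, and \<open>f\<close> takes the same value there.\<close>

lemma not_thin_of_age_algebra:
  assumes "relational_structure R" "rel_kernel R = {}"
    and f: "f \<in> carrier (age_algebra R)" "f \<noteq> (\<lambda>P. 0)"
  shows "\<not> thin f"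
proof
  assume "thin f"
  then obtain T where T: "finite T" "\<And>P. finite P \<Longrightarrow> P \<inter> T = {} \<Longrightarrow> f P = 0"
    by (auto simp: eventually_off_finite)
  obtain F where F: "F \<in> Fpow (universe R)" "f F \<noteq> 0"
    using f by (auto simp: carrier_age_algebra carrier_set_algebra fun_eq_iff)
  obtain F' where F': "F' \<in> Fpow (universe R)" "F' \<inter> T = {}" "age_equiv R F F'"
    using age_equiv_avoiding_finite[OF assms(1,2) F(1) T(1)] by blast
  have "f F = f F'" using f(1) F F' by (auto simp: carrier_age_algebra)
  moreover have "f F' = 0" using T(2) F' by (auto simp: Fpow_def)
  ultimately show False using F by simp
qed

theorem mainTheorem2:
  fixes R :: "('a, 'i) rel_structure"
  assumes "relational_structure R"
    and "rel_kernel R = {}"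
  shows "domain (age_algebra R :: ('k::field_char_0, 'a set \<Rightarrow> 'k) module)"
proof (rule domain.intro[OF cring_age_algebra], unfold_locales)
  let ?A = "age_algebra R :: ('k, 'a set \<Rightarrow> 'k) module"
  show "\<one>\<^bsub>?A\<^esub> \<noteq> \<zero>\<^bsub>?A\<^esub>" by (auto simp: conv_one_def fun_eq_iff)
  fix f g assume fg: "f \<otimes>\<^bsub>?A\<^esub> g = \<zero>\<^bsub>?A\<^esub>" and f: "f \<in> carrier ?A" and g: "g \<in> carrier ?A"
  obtain n where n: "\<And>P. P \<in> Fpow (universe R) \<Longrightarrow> n \<le> card P \<Longrightarrow> g P = 0"
    using g unfolding carrier_age_algebra carrier_set_algebra by meson
  \<comment> \<open>The filter also involves finite sets not contained in the domain of
    \<open>R\<close>; there \<open>g\<close> is 0 by the convention on extending maps.\<close>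
  have "n \<le> card P \<longrightarrow> g P = 0" for P
    using n g by (cases "P \<in> Fpow (universe R)") (auto simp: carrier_age_algebra carrier_set_algebra)
  moreover have "thin (conv f g)" using fg by simp
  ultimately have "thin f \<or> thin g" using thin_of_thin_conv[of n g f] by auto
  then show "f = \<zero>\<^bsub>?A\<^esub> \<or> g = \<zero>\<^bsub>?A\<^esub>"
    using not_thin_of_age_algebra[OF assms] f g by auto
qed

end
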